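(* Let $N\in\mathbb{N}$, let $\mathcal{F}:=\{f:\mathbb{R}^N\to\mathbb{R}^N \text{ bilipschitz}\}$, and let $h$ be a dimension function. There exists a perfect set $E\subseteq\mathbb{R}^N$ with $\mathcal{H}^h(E)=0$ such that $\bigcap_{i=1}^n f_i(E)\neq\emptyset$ for any finite subset $\{f_1,\dots,f_n\}\subseteq\mathcal{F}$.
   Context: A dimension function is a function $h:\mathbb{R}_{\ge0}\to\mathbb{R}\cup\{+\infty\}$ that is non-decreasing and right continuous, with $h(0)=0$ and $h(t)>0$ for $t>0$. The associated (outer) Hausdorff measure is $\mathcal{H}^h(E)=\lim_{\delta\to0}\inf\{\sum_i h(|U_i|):\{U_i\}_i\text{ a (countable) }\delta\text{-covering of }E\}$, where $|U|$ is the diameter of $U$ and a $\delta$-covering is a covering by sets of diameter at most $\delta$. A map $f:\mathbb{R}^N\to\mathbb{R}^N$ is bilipschitz if there are constants $c_1,c_2>0$ with $c_1\|x-y\|\le\|f(x)-f(y)\|\le c_2\|x-y\|$ for all $x,y\in\mathbb{R}^N$. A perfect set is a closed set without isolated points. *)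

theory Defs
  imports "HOL-Analysis.Analysis"
begin

text \<open>
  A dimension function has domain \<open>[0, \<infinity>)\<close>, so only its values there are constrained. Its values are
  nonnegative by monotonicity and \<open>h 0 = 0\<close>, so the codomain is \<^typ>\<open>ennreal\<close>.
\<close>
definition dimension_function :: "(real \<Rightarrow> ennreal) \<Rightarrow> bool" where
  "dimension_function h \<longleftrightarrow>
     mono_on {0..} h \<and> (\<forall>t\<ge>0. continuous (at_right t) h) \<and> h 0 = 0 \<and> (\<forall>t>0. h t > 0)"

text \<open>
  Boundedness is required explicitly because \<^const>\<open>diameter\<close> is a real number and carries no
  information for unbounded sets. Finite coverings are included by padding with empty sets, since
  \<open>diameter {} = 0\<close> and \<open>h 0 = 0\<close>.
\<close>
definition delta_covering :: "real \<Rightarrow> 'a::metric_space set \<Rightarrow> (nat \<Rightarrow> 'a set) \<Rightarrow> bool" where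
  "delta_covering \<delta> E U \<longleftrightarrow>
     E \<subseteq> (\<Union>i. U i) \<and> (\<forall>i. bounded (U i) \<and> diameter (U i) \<le> \<delta>)"

definition hausdorff_measure :: "(real \<Rightarrow> ennreal) \<Rightarrow> 'a::metric_space set \<Rightarrow> ennreal" where
  "hausdorff_measure h E =
     Lim (at_right 0) (\<lambda>\<delta>. INF U\<in>{U. delta_covering \<delta> E U}. \<Sum>i. h (diameter (U i)))"

definition bilipschitz :: "('a::real_normed_vector \<Rightarrow> 'a) \<Rightarrow> bool" where
  "bilipschitz f \<longleftrightarrow>
     (\<exists>c1>0. \<exists>c2>0. \<forall>x y.
        c1 * norm (x - y) \<le> norm (f x - f y) \<and> norm (f x - f y) \<le> c2 * norm (x - y))"

definition perfect_set :: "'a::topological_space set \<Rightarrow> bool" where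
  "perfect_set E \<longleftrightarrow> closed E \<and> (\<nexists>x. x isolated_in E)"

end

theory Submission
  imports Defs
begin

text \<open>
  Choose radii \<open>r j\<close> and locally finite nets \<open>D j\<close> inductively, the net so dense that every
  ball of radius \<open>r (j - 1)\<close>, even after a bilipschitz distortion with constant at most \<open>j\<close>,
  has a net point well inside it, and \<open>r j\<close> so small that the balls of radius comparable to
  \<open>r j\<close> about the net points in a large bounded region have negligible total \<open>h\<close>-size.
  Distribute the stages \<open>j\<close> among infinitely many roles, each role occurring infinitely often.
  The set of points that are close to \<open>D j\<close> at all stages of role \<open>m\<close> is null. Given finitely
  many bilipschitz maps, assign distinct large roles to them: since each stage constrains only one
  of the maps, a nested sequence of balls yields a common point of the images. Removing ever larger
  balls from the sets of later roles makes their union locally finite; translations are still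
  covered because the nested balls may start arbitrarily far away.
\<close>

section \<open>Bilipschitz maps and locally finite nets\<close>

text \<open>The lower bound gives injectivity and makes preimages of Cauchy sequences Cauchy, so the
  range is complete. Invariance of domain makes the range open, and connectedness leaves only the
  whole space.\<close>

lemma bilipschitz_bij:
  fixes f :: "'a::euclidean_space \<Rightarrow> 'a"
  assumes "bilipschitz f"
  shows "bij f"
proof -
  obtain c1 c2 where c: "c1 > 0" "c2 > 0"
    and lower: "\<And>x y. c1 * norm (x - y) \<le> norm (f x - f y)"
    and upper: "\<And>x y. norm (f x - f y) \<le> c2 * norm (x - y)"
    using assms unfolding bilipschitz_def by blast
  have inj: "inj f"
  proof (rule injI)
    fix x y assume "f x = f y"
    then have "c1 * norm (x - y) \<le> 0" using lower[of x y] by simp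
    then show "x = y" using c(1) by (simp add: mult_le_0_iff)
  qed
  have cont: "continuous_on UNIV f"
    by (rule lipschitz_on_continuous_on[of c2])
       (use upper c(2) in \<open>auto simp: lipschitz_on_def dist_norm\<close>)
  have op: "open (range f)"
    using invariance_of_domain[OF cont open_UNIV inj] .
  have "complete (range f)"
    unfolding complete_def
  proof (intro allI impI)
    fix s assume s: "(\<forall>n. s n \<in> range f) \<and> Cauchy s"
    then have "\<forall>n. \<exists>x. s n = f x" by blast
    then obtain t where t: "\<And>n. s n = f (t n)" by metis
    have "Cauchy t"
      unfolding Cauchy_def
    proof (intro allI impI)
      fix e :: real assume "e > 0"
      then obtain M where M: "\<And>m n. m \<ge> M \<Longrightarrow> n \<ge> M \<Longrightarrow> dist (s m) (s n) < c1 * e"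
        using metric_CauchyD[of s "c1 * e"] s c(1) by auto
      have "dist (t m) (t n) < e" if "m \<ge> M" "n \<ge> M" for m n
      proof -
        have "c1 * dist (t m) (t n) < c1 * e"
          using M[OF that] lower[of "t m" "t n"] by (simp add: t dist_norm)
        then show ?thesis using c(1) by simp
      qed
      then show "\<exists>M. \<forall>m\<ge>M. \<forall>n\<ge>M. dist (t m) (t n) < e" by blast
    qed
    then obtain l where "t \<longlonglongrightarrow> l" using Cauchy_convergent_iff convergent_def by blast
    then have "(\<lambda>n. f (t n)) \<longlonglongrightarrow> f l"
      using cont by (auto intro: continuous_on_tendsto_compose)
    moreover have "s = (\<lambda>n. f (t n))" using t by (rule ext)
    ultimately have "s \<longlonglongrightarrow> f l" by simp
    then show "\<exists>l\<in>range f. s \<longlonglongrightarrow> l" by blast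
  qed
  then have "closed (range f)" by (rule complete_imp_closed)
  with op have "range f = UNIV"
    using clopen[of "range f"] by auto
  with inj show ?thesis by (simp add: bij_def)
qed

lemma bilipschitz_constant:
  fixes f :: "'a::euclidean_space \<Rightarrow> 'a"
  assumes "bilipschitz f"
  shows "\<exists>K\<ge>0. \<forall>x y. dist (f x) (f y) \<le> K * dist x y \<and> dist (inv f x) (inv f y) \<le> K * dist x y"
proof -
  obtain c1 c2 where c: "c1 > 0" "c2 > 0"
    and lower: "\<And>x y. c1 * norm (x - y) \<le> norm (f x - f y)"
    and upper: "\<And>x y. norm (f x - f y) \<le> c2 * norm (x - y)"
    using assms unfolding bilipschitz_def by blast
  have surj: "f (inv f x) = x" for x
    using bilipschitz_bij[OF assms] by (simp add: bij_is_surj surj_f_inv_f)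
  define K where "K = max c2 (1 / c1)"
  have "dist (f x) (f y) \<le> K * dist x y" for x y
  proof -
    have "dist (f x) (f y) \<le> c2 * dist x y" using upper[of x y] by (simp add: dist_norm)
    also have "\<dots> \<le> K * dist x y" by (intro mult_right_mono) (auto simp: K_def)
    finally show ?thesis .
  qed
  moreover have "dist (inv f x) (inv f y) \<le> K * dist x y" for x y
  proof -
    have "dist (inv f x) (inv f y) \<le> (1 / c1) * dist x y"
      using lower[of "inv f x" "inv f y"] c(1) by (simp add: surj dist_norm field_simps)
    also have "\<dots> \<le> K * dist x y" by (intro mult_right_mono) (auto simp: K_def)
    finally show ?thesis .
  qed
  moreover have "K \<ge> 0" using c by (simp add: K_def)
  ultimately show ?thesis by blast
qed

text \<open>The nested balls need one constant for all maps and their inverses. A sum of the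
  individual constants dominates each of them; the summand 1 gives \<open>K \<ge> 1\<close> even for
  empty \<open>F\<close>.\<close>

lemma uniform_bilipschitz_constant:
  fixes F :: "('a::euclidean_space \<Rightarrow> 'a) set"
  assumes "finite F" and "\<And>f. f \<in> F \<Longrightarrow> bilipschitz f"
  obtains K where "K \<ge> 1"
    and "\<And>f x y. f \<in> F \<Longrightarrow> dist (f x) (f y) \<le> K * dist x y"
    and "\<And>f x y. f \<in> F \<Longrightarrow> dist (inv f x) (inv f y) \<le> K * dist x y"
proof -
  obtain k where k: "\<And>f. f \<in> F \<Longrightarrow> k f \<ge> 0 \<and> (\<forall>x y. dist (f x) (f y) \<le> k f * dist x y \<and>
      dist (inv f x) (inv f y) \<le> k f * dist x y)"
    using bilipschitz_constant assms(2) by metis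
  define K where "K = 1 + sum k F"
  have "k f \<le> K" if "f \<in> F" for f
    using member_le_sum[of f F k] k assms(1) that by (force simp: K_def)
  then have "k f * dist x y \<le> K * dist x y" if "f \<in> F" for f and x y :: 'a
    using that by (simp add: mult_right_mono)
  moreover have "K \<ge> 1" using k by (simp add: K_def sum_nonneg)
  ultimately show thesis using that[of K] k by (meson order_trans)
qed

text \<open>Each closed shell between the radii \<open>k\<close> and \<open>k + 1\<close> is compact
  and has a finite net. A ball of radius \<open>R\<close> meets only the shells with
  \<open>k \<le> R\<close>, so the union of these nets is locally finite.\<close>

lemma locally_finite_net:
  fixes s :: real
  assumes "s > 0"
  obtains D :: "'a::{real_normed_vector, heine_borel} set"
  where "\<And>R. finite (D \<inter> cball 0 R)" and "\<And>x. \<exists>p\<in>D. dist x p < s"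
proof -
  define A :: "nat \<Rightarrow> 'a set" where "A k = cball 0 (real (Suc k)) - ball 0 (real k)" for k
  have "\<exists>T\<subseteq>A k. finite T \<and> A k \<subseteq> (\<Union>p\<in>T. ball p s)" for k
  proof -
    have "compact (A k)" unfolding A_def by (intro compact_diff compact_cball open_ball)
    then obtain T where "T \<subseteq> A k" "finite T" "A k \<subseteq> (\<Union>p\<in>T. ball p s)"
      by (rule compactE_image[where C = "A k" and f = "\<lambda>p. ball p s"]) (use assms in auto)
    then show ?thesis by blast
  qed
  then obtain T where T: "\<And>k. T k \<subseteq> A k" "\<And>k. finite (T k)" "\<And>k. A k \<subseteq> (\<Union>p\<in>T k. ball p s)"
    by metis
  show thesis
  proof (rule that[of "\<Union>k. T k"])
    fix R :: real
    have "(\<Union>k. T k) \<inter> cball 0 R \<subseteq> (\<Union>k\<le>nat \<lceil>R\<rceil>. T k)"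
    proof
      fix x assume "x \<in> (\<Union>k. T k) \<inter> cball 0 R"
      then obtain k where "x \<in> T k" "norm x \<le> R" by auto
      moreover have "real k \<le> norm x" using T(1) \<open>x \<in> T k\<close> by (force simp: A_def)
      ultimately have "k \<le> nat \<lceil>R\<rceil>" by linarith
      with \<open>x \<in> T k\<close> show "x \<in> (\<Union>k\<le>nat \<lceil>R\<rceil>. T k)" by blast
    qed
    then show "finite ((\<Union>k. T k) \<inter> cball 0 R)" by (rule finite_subset) (simp add: T(2))
  next
    fix x :: 'a
    have "x \<in> A (nat \<lfloor>norm x\<rfloor>)" by (simp add: A_def) linarith
    then show "\<exists>p\<in>\<Union>k. T k. dist x p < s"
      using T(3) by (fastforce simp: dist_commute)
  qed
qed

section \<open>Null sets of the Hausdorff measure\<close>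

text \<open>Measure zero expressed by coverings at every scale, so that subsets and countable unions
  can be treated without the limit in \<open>hausdorff_measure\<close>.\<close>

definition hausdorff_null :: "(real \<Rightarrow> ennreal) \<Rightarrow> 'a::metric_space set \<Rightarrow> bool" where
  "hausdorff_null h E \<longleftrightarrow> (\<forall>\<delta>>0. \<forall>\<epsilon>::real>0.
     \<exists>U. delta_covering \<delta> E U \<and> (\<Sum>i. h (diameter (U i))) \<le> ennreal \<epsilon>)"

lemma hausdorff_measure_null:
  assumes "hausdorff_null h E"
  shows "hausdorff_measure h E = 0"
proof -
  let ?I = "\<lambda>\<delta>. INF U\<in>{U. delta_covering \<delta> E U}. \<Sum>i. h (diameter (U i))"
  have "?I \<delta> = 0" if "\<delta> > 0" for \<delta>
  proof -
    have "?I \<delta> \<le> 0 + ennreal \<epsilon>" if "\<epsilon> > 0" for \<epsilon>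
    proof -
      obtain U where "delta_covering \<delta> E U" "(\<Sum>i. h (diameter (U i))) \<le> ennreal \<epsilon>"
        using assms \<open>\<delta> > 0\<close> \<open>\<epsilon> > 0\<close> unfolding hausdorff_null_def by blast
      then show ?thesis by (intro INF_lower2[of U]) auto
    qed
    then have "?I \<delta> \<le> 0" by (rule ennreal_le_epsilon)
    then show ?thesis by simp
  qed
  then have "\<forall>\<^sub>F \<delta> in at_right 0. ?I \<delta> = 0"
    by (auto simp: eventually_at_filter)
  then have "(?I \<longlongrightarrow> 0) (at_right 0)" by (rule tendsto_eventually)
  then show ?thesis
    unfolding hausdorff_measure_def by (intro tendsto_Lim) auto
qed

lemma hausdorff_null_subset:
  assumes "hausdorff_null h B" "A \<subseteq> B"
  shows "hausdorff_null h A"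
  using assms unfolding hausdorff_null_def delta_covering_def by (meson order_trans)

text \<open>The \<open>n\<close>-th set gets the share \<open>\<epsilon> / 2^(n+1)\<close>, and the
  doubly indexed covering is flattened by the pairing bijection.\<close>

lemma hausdorff_null_UN:
  fixes A :: "nat \<Rightarrow> 'a::metric_space set"
  assumes "\<And>n. hausdorff_null h (A n)"
  shows "hausdorff_null h (\<Union>n. A n)"
  unfolding hausdorff_null_def
proof (intro allI impI)
  fix \<delta> \<epsilon> :: real assume pos: "\<delta> > 0" "\<epsilon> > 0"
  have "\<exists>U. delta_covering \<delta> (A n) U \<and> (\<Sum>i. h (diameter (U i))) \<le> ennreal (\<epsilon> * (1/2) ^ Suc n)" for n
    using assms[of n] pos unfolding hausdorff_null_def by simp
  then obtain U where U: "\<And>n. delta_covering \<delta> (A n) (U n)"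
      "\<And>n. (\<Sum>i. h (diameter (U n i))) \<le> ennreal (\<epsilon> * (1/2) ^ Suc n)"
    by metis
  define V where "V = (\<lambda>k. case_prod U (prod_decode k))"
  have "\<exists>k. x \<in> V k" if x: "x \<in> A n" for x n
  proof -
    obtain i where "x \<in> U n i" using U(1)[of n] x unfolding delta_covering_def by blast
    then have "x \<in> V (prod_encode (n, i))" by (simp add: V_def)
    then show ?thesis ..
  qed
  moreover have "bounded (V k) \<and> diameter (V k) \<le> \<delta>" for k
    using U(1) by (auto simp: V_def delta_covering_def split: prod.split)
  ultimately have cov: "delta_covering \<delta> (\<Union>n. A n) V" unfolding delta_covering_def by blast
  have "(\<Sum>k. h (diameter (V k))) = (\<Sum>k. (\<lambda>p. h (diameter (case_prod U p))) (prod_decode k))"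
    by (simp add: V_def)
  also have "\<dots> = (\<Sum>n. \<Sum>i. h (diameter (U n i)))"
    by (rule suminf_ennreal_2dimen) simp
  also have "\<dots> \<le> (\<Sum>n. ennreal (\<epsilon> * (1/2) ^ Suc n))"
    by (intro suminf_le U(2)) auto
  also have "\<dots> = ennreal (\<epsilon> * 1)"
    using pos by (intro suminf_ennreal_eq sums_mult power_half_series) auto
  finally have "(\<Sum>k. h (diameter (V k))) \<le> ennreal \<epsilon>" by simp
  with cov show "\<exists>U. delta_covering \<delta> (\<Union>n. A n) U \<and> (\<Sum>i. h (diameter (U i))) \<le> ennreal \<epsilon>"
    by blast
qed

text \<open>The sum is exact: a closed Euclidean ball of radius \<open>r\<close> has diameter
  \<open>2 * r\<close>, and the empty sets that pad the covering contribute
  \<open>h 0 = 0\<close>.\<close>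

lemma finite_ball_covering:
  fixes P :: "'a::euclidean_space set" and h :: "real \<Rightarrow> ennreal"
  assumes "finite P" "0 \<le> r" "h 0 = 0"
  obtains U where "delta_covering (2 * r) (\<Union>p\<in>P. cball p r) U"
    and "(\<Sum>i. h (diameter (U i))) = of_nat (card P) * h (2 * r)"
proof -
  obtain b where b: "bij_betw b {0..<card P} P"
    using ex_bij_betw_nat_finite[OF assms(1)] by blast
  define U where "U = (\<lambda>i. if i < card P then cball (b i) r else {})"
  have "(\<Union>i. U i) = (\<Union>i\<in>{0..<card P}. cball (b i) r)"
    by (auto simp: U_def split: if_splits)
  also have "\<dots> = (\<Union>p\<in>P. cball p r)"
    using b by (simp add: bij_betw_def flip: image_image[of "\<lambda>p. cball p r" b])
  finally have "delta_covering (2 * r) (\<Union>p\<in>P. cball p r) U"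
    using assms(2) unfolding delta_covering_def by (auto simp: U_def)
  moreover have "(\<Sum>i. h (diameter (U i))) = (\<Sum>i<card P. h (diameter (U i)))"
    by (rule suminf_finite) (auto simp: U_def assms(3))
  then have "(\<Sum>i. h (diameter (U i))) = of_nat (card P) * h (2 * r)"
    using assms(2) by (simp add: U_def)
  ultimately show thesis by (rule that)
qed

section \<open>Sparse nets at rapidly decreasing scales\<close>

text \<open>
  Every \<open>m\<close> is the role of infinitely many stages, and a role \<open>m\<close> imposes nothing on the
  stages before \<open>m\<close>.
\<close>
definition role :: "nat \<Rightarrow> nat" where
  "role j = fst (prod_decode j)"

lemma role_le: "role j \<le> j"
  unfolding role_def by (metis le_prod_encode_1 prod.collapse prod_decode_inverse)

lemma role_unbounded: "\<exists>j\<ge>k. role j = m"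
  unfolding role_def by (metis le_prod_encode_2 fst_conv prod_encode_inverse)

text \<open>The number \<open>10 * r j\<close> is the diameter of a ball of radius
  \<open>5 * r j\<close>, the larger tolerance allowed in \<open>sparse\<close>. In
  \<open>net_dense\<close> the factor \<open>(Suc j)\<^sup>2\<close> absorbs two factors
  \<open>K\<close> of a bilipschitz constant \<open>K \<le> Suc j\<close>, and the summand
  \<open>r (Suc j)\<close> leaves room for the next ball.\<close>

locale sparse_nets =
  fixes h :: "real \<Rightarrow> ennreal" and r :: "nat \<Rightarrow> real" and D :: "nat \<Rightarrow> 'a::euclidean_space set"
  assumes h_0: "h 0 = 0"
    and r_pos: "0 < r j"
    and r_small: "10 * r j \<le> 1 / Suc j"
    and finite_net: "finite (D j \<inter> cball 0 R)"
    and net_null: "of_nat (card (D j \<inter> cball 0 (Suc j))) * h (10 * r j) \<le> ennreal (1 / Suc j)"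
    and net_dense: "\<exists>p\<in>D (Suc j). (Suc j)\<^sup>2 * dist x p + r (Suc j) \<le> r j"
begin

lemma r_Suc: "r (Suc j) \<le> r j"
proof -
  obtain p where "(Suc j)\<^sup>2 * dist (0::'a) p + r (Suc j) \<le> r j" using net_dense by blast
  moreover have "0 \<le> (Suc j)\<^sup>2 * dist (0::'a) p" by simp
  ultimately show ?thesis by linarith
qed

lemma r_mono: "i \<le> j \<Longrightarrow> r j \<le> r i"
  using lift_Suc_antimono_le[of r] r_Suc by blast

lemma r_eventually_small:
  assumes "0 < \<epsilon>"
  shows "\<exists>J\<ge>k. r J < \<epsilon>"
proof -
  obtain n where n: "inverse (real (Suc n)) < \<epsilon>" using reals_Archimedean[OF assms] by blast
  have "10 * r n < \<epsilon>" using r_small[of n] n by (simp add: inverse_eq_divide)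
  then have "r n < \<epsilon>" using r_pos[of n] by linarith
  moreover have "r (max n k) \<le> r n" by (intro r_mono) simp
  ultimately show ?thesis by (intro exI[of _ "max n k"]) auto
qed

text \<open>
  The maps are handled in turn: at a stage of role \<open>m\<close> the current ball is shrunk to one whose
  image under \<open>g m\<close> lies near a single net point.
\<close>
lemma nested_balls:
  fixes f g :: "nat \<Rightarrow> 'a \<Rightarrow> 'a"
  assumes K: "1 \<le> K" "K \<le> real J"
    and f: "\<And>m x x'. m \<in> I \<Longrightarrow> dist (f m x) (f m x') \<le> K * dist x x'"
    and g: "\<And>m x x'. m \<in> I \<Longrightarrow> dist (g m x) (g m x') \<le> K * dist x x'"
    and fg: "\<And>m x. m \<in> I \<Longrightarrow> f m (g m x) = x"
    and gf: "\<And>m x. m \<in> I \<Longrightarrow> g m (f m x) = x"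
  obtains z where "dist y z \<le> r J / K"
    and "\<And>j. J < j \<Longrightarrow> role j \<in> I \<Longrightarrow> \<exists>p\<in>D j. dist p (g (role j) z) \<le> r j"
proof -
  define good where "good = (\<lambda>j z. role j \<in> I \<longrightarrow> (\<exists>p\<in>D j. dist p (g (role j) z) \<le> r j))"
  \<comment> \<open>Radii are divided by \<open>K\<close> because \<open>g m\<close> expands
    distances by at most \<open>K\<close>: it takes the ball of radius \<open>r (Suc j) / K\<close>
    about \<open>f m p\<close> into the ball of radius \<open>r (Suc j)\<close> about
    \<open>p\<close>.\<close>
  have step: "\<exists>c'. cball c' (r (Suc j) / K) \<subseteq> cball c (r j / K) \<and>
      (\<forall>z\<in>cball c' (r (Suc j) / K). good (Suc j) z)" if "J \<le> j" for j c
  proof (cases "role (Suc j) \<in> I")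
    case False
    moreover have "r (Suc j) / K \<le> r j / K" using r_Suc K by (simp add: divide_right_mono)
    ultimately show ?thesis by (intro exI[of _ c]) (auto simp: good_def)
  next
    case True
    let ?m = "role (Suc j)"
    obtain p where p: "p \<in> D (Suc j)" "(Suc j)\<^sup>2 * dist (g ?m c) p + r (Suc j) \<le> r j"
      using net_dense by blast
    have "dist c (f ?m p) \<le> K * dist (g ?m c) p"
      using f[OF True, of "g ?m c" p] by (simp add: fg[OF True])
    \<comment> \<open>One factor \<open>K\<close> comes from the distortion by \<open>f\<close>, the
      other from clearing the denominator of the radii.\<close>
    then have "K * dist c (f ?m p) \<le> K * (K * dist (g ?m c) p)"
      using K by (intro mult_left_mono) auto
    also have "\<dots> = K\<^sup>2 * dist (g ?m c) p" by (simp add: power2_eq_square)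
    also have "\<dots> \<le> (Suc j)\<^sup>2 * dist (g ?m c) p"
      using K \<open>J \<le> j\<close> by (intro mult_right_mono power_mono) auto
    finally have "K * dist c (f ?m p) + r (Suc j) \<le> r j" using p(2) by linarith
    then have near: "dist c (f ?m p) + r (Suc j) / K \<le> r j / K"
    proof -
      have "dist c (f ?m p) + r (Suc j) / K = (K * dist c (f ?m p) + r (Suc j)) / K"
        using K by (simp add: add_divide_distrib)
      also have "\<dots> \<le> r j / K"
        using \<open>K * dist c (f ?m p) + r (Suc j) \<le> r j\<close> K by (intro divide_right_mono) auto
      finally show ?thesis .
    qed
    have "cball (f ?m p) (r (Suc j) / K) \<subseteq> cball c (r j / K)"
    proof
      fix z assume "z \<in> cball (f ?m p) (r (Suc j) / K)"
      then show "z \<in> cball c (r j / K)"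
        using near dist_triangle[of c z "f ?m p"] by simp
    qed
    moreover have "good (Suc j) z" if "z \<in> cball (f ?m p) (r (Suc j) / K)" for z
    proof -
      have "dist p (g ?m z) \<le> K * dist (f ?m p) z"
        using g[OF True, of "f ?m p" z] by (simp add: gf[OF True])
      also have "\<dots> \<le> r (Suc j)" using that K by (simp add: field_simps)
      finally show ?thesis using p(1) by (auto simp: good_def)
    qed
    ultimately show ?thesis by blast
  qed
  \<comment> \<open>The clause for \<open>k = 0\<close> makes the dependent choice start at the
    prescribed centre \<open>y\<close>.\<close>
  have "\<exists>c. \<forall>k. (k = 0 \<longrightarrow> c k = y) \<and>
      cball (c (Suc k)) (r (J + Suc k) / K) \<subseteq> cball (c k) (r (J + k) / K) \<and>
      (\<forall>z\<in>cball (c (Suc k)) (r (J + Suc k) / K). good (J + Suc k) z)"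
  proof (rule dependent_nat_choice)
    show "\<exists>x. (0::nat) = 0 \<longrightarrow> x = y" by blast
  next
    fix x :: 'a and k :: nat
    show "\<exists>c'. (Suc k = 0 \<longrightarrow> c' = y) \<and>
        cball c' (r (J + Suc k) / K) \<subseteq> cball x (r (J + k) / K) \<and>
        (\<forall>z\<in>cball c' (r (J + Suc k) / K). good (J + Suc k) z)"
      using step[of "J + k" x] by simp
  qed
  then obtain c where "\<forall>k. (k = 0 \<longrightarrow> c k = y) \<and>
      cball (c (Suc k)) (r (J + Suc k) / K) \<subseteq> cball (c k) (r (J + k) / K) \<and>
      (\<forall>z\<in>cball (c (Suc k)) (r (J + Suc k) / K). good (J + Suc k) z)" ..
  then have c: "c 0 = y"
    "\<And>k. cball (c (Suc k)) (r (J + Suc k) / K) \<subseteq> cball (c k) (r (J + k) / K)"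
    "\<And>k z. z \<in> cball (c (Suc k)) (r (J + Suc k) / K) \<Longrightarrow> good (J + Suc k) z"
    by blast+
  define B where "B k = cball (c k) (r (J + k) / K)" for k
  obtain z where z: "\<And>k. z \<in> B k"
  proof (rule bounded_closed_nest[of B])
    show "closed (B k)" for k by (simp add: B_def)
    show "B k \<noteq> {}" for k
      using r_pos[of "J + k"] K by (simp add: B_def not_less)
    show "B n \<subseteq> B m" if "m \<le> n" for m n
      using lift_Suc_antimono_le[of B, OF _ that] c(2) unfolding B_def by blast
    show "bounded (B 0)" by (simp add: B_def)
  qed blast
  show thesis
  proof (rule that)
    show "dist y z \<le> r J / K" using z[of 0] by (simp add: B_def c(1))
  next
    fix j assume "J < j" "role j \<in> I"
    then obtain k where "j = J + Suc k" using less_iff_Suc_add by auto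
    then have "good j z" using c(3) z[of "Suc k"] by (simp add: B_def)
    then show "\<exists>p\<in>D j. dist p (g (role j) z) \<le> r j" using \<open>role j \<in> I\<close> by (simp add: good_def)
  qed
qed

section \<open>Sets close to the nets at all stages of one role\<close>

text \<open>
  The stronger eventual condition leaves enough room around a point of \<open>sparse m\<close> to find others
  nearby.
\<close>
definition sparse :: "nat \<Rightarrow> 'a set" where
  "sparse m = {x. (\<forall>j. role j = m \<longrightarrow> (\<exists>p\<in>D j. dist p x < 5 * r j)) \<and>
     (\<exists>j0. \<forall>j\<ge>j0. role j = m \<longrightarrow> (\<exists>p\<in>D j. dist p x \<le> r j))}"

text \<open>The stages before \<open>j0\<close> impose finitely many open conditions, which persist
  near \<open>x\<close>. At stages from \<open>j0\<close> to \<open>J\<close>, moving by at most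
  \<open>3 * r J\<close> raises the distance to the net from \<open>r j\<close> to at most
  \<open>4 * r j\<close>, still below \<open>5 * r j\<close>. Later stages are handled by nested
  balls for the identity map.\<close>

lemma sparse_islimpt:
  assumes x: "x \<in> sparse m" and G: "open G" "x \<in> G"
  shows "\<exists>z\<in>sparse m \<inter> G. z \<noteq> x"
proof -
  obtain j0 where j0: "\<And>j. j0 \<le> j \<Longrightarrow> role j = m \<Longrightarrow> \<exists>p\<in>D j. dist p x \<le> r j"
    and near: "\<And>j. role j = m \<Longrightarrow> \<exists>p\<in>D j. dist p x < 5 * r j"
    using x by (auto simp: sparse_def)
  define G' where "G' = G \<inter> (\<Inter>j\<in>{j. j < j0 \<and> role j = m}. \<Union>p\<in>D j. ball p (5 * r j))"
  have "open G'" unfolding G'_def using G(1) by (intro open_Int open_INT) auto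
  moreover have "x \<in> G'" using G(2) near by (auto simp: G'_def)
  ultimately obtain \<eta> where \<eta>: "0 < \<eta>" "ball x \<eta> \<subseteq> G'" using open_contains_ball by blast
  \<comment> \<open>The bound \<open>1 \<le> J\<close> lets \<open>nested_balls\<close> be applied
    with \<open>K = 1\<close>.\<close>
  obtain J where J: "max 1 j0 \<le> J" "r J < \<eta> / 3"
    using r_eventually_small[of "\<eta> / 3" "max 1 j0"] \<eta>(1) by auto
  \<comment> \<open>The starting centre is \<open>2 * r J\<close> away from \<open>x\<close> and the
    starting ball has radius \<open>r J\<close>, so \<open>z\<close> stays at distance at least
    \<open>r J\<close> from \<open>x\<close> and at most \<open>3 * r J\<close>.\<close>
  obtain u :: 'a where u: "norm u = 2 * r J"
    using vector_choose_size[of "2 * r J"] r_pos[of J] by auto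
  obtain z where z: "dist (x + u) z \<le> r J"
    and z_net: "\<And>j. J < j \<Longrightarrow> role j = m \<Longrightarrow> \<exists>p\<in>D j. dist p z \<le> r j"
    using nested_balls[of 1 J "{m}" "\<lambda>_ x. x" "\<lambda>_ x. x" "x + u"] J(1) by auto
  have dx: "dist x (x + u) = 2 * r J" using u by (simp add: dist_norm)
  have upper: "dist x z \<le> 3 * r J"
    using dist_triangle[of x z "x + u"] dx z by linarith
  have "0 < dist x z"
    using dist_triangle[of x "x + u" z] dx z r_pos[of J] dist_commute[of z "x + u"] by linarith
  then have "z \<noteq> x" by auto
  have "z \<in> ball x \<eta>" using upper J(2) by simp
  then have "z \<in> G'" using \<eta>(2) by blast
  have "\<exists>p\<in>D j. dist p z < 5 * r j" if j: "role j = m" for j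
  proof -
    consider "j < j0" | "j0 \<le> j" "j \<le> J" | "J < j" by linarith
    then show ?thesis
    proof cases
      case 1
      then show ?thesis using \<open>z \<in> G'\<close> j by (auto simp: G'_def)
    next
      case 2
      then obtain p where p: "p \<in> D j" "dist p x \<le> r j" using j0 j by blast
      have "dist p z < 5 * r j"
        using dist_triangle[of p z x] p(2) upper r_mono[OF 2(2)] r_pos[of j] by linarith
      with p(1) show ?thesis by blast
    next
      case 3
      then obtain p where "p \<in> D j" "dist p z \<le> r j" using z_net j by blast
      moreover have "r j < 5 * r j" using r_pos[of j] by simp
      ultimately show ?thesis by force
    qed
  qed
  moreover have "\<forall>j\<ge>Suc J. role j = m \<longrightarrow> (\<exists>p\<in>D j. dist p z \<le> r j)" using z_net by simp
  ultimately have "z \<in> sparse m" unfolding sparse_def by blast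
  with \<open>z \<in> G'\<close> \<open>z \<noteq> x\<close> show ?thesis by (auto simp: G'_def)
qed

text \<open>A single late stage \<open>j\<close> of role \<open>m\<close> gives the covering. Since
  \<open>5 * r j \<le> 1\<close> and \<open>M \<le> j\<close>, only net points of norm at most
  \<open>Suc j\<close> matter; their finitely many closed balls form a closed set, which contains
  the closure too.\<close>

lemma sparse_null:
  "hausdorff_null h (closure (sparse m) \<inter> ball 0 (real M))"
  unfolding hausdorff_null_def
proof (intro allI impI)
  fix \<delta> \<epsilon> :: real assume pos: "\<delta> > 0" "\<epsilon> > 0"
  obtain n where n: "inverse (real (Suc n)) < min \<delta> \<epsilon>"
    using reals_Archimedean[of "min \<delta> \<epsilon>"] pos by auto
  obtain j where j: "max n M \<le> j" "role j = m" using role_unbounded by blast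
  have "1 / real (Suc j) \<le> inverse (real (Suc n))" using j(1) by (simp add: field_simps)
  then have j_small: "1 / real (Suc j) \<le> \<delta>" "1 / real (Suc j) \<le> \<epsilon>" using n by linarith+
  define P where "P = D j \<inter> cball 0 (Suc j)"
  have "finite P" unfolding P_def by (rule finite_net)
  then obtain U where U: "delta_covering (2 * (5 * r j)) (\<Union>p\<in>P. cball p (5 * r j)) U"
    "(\<Sum>i. h (diameter (U i))) = of_nat (card P) * h (2 * (5 * r j))"
    using r_pos[of j] h_0 by (auto intro: finite_ball_covering[of P "5 * r j" h])
  have "sparse m \<inter> ball 0 (real M) \<subseteq> (\<Union>p\<in>P. cball p (5 * r j))"
  proof
    fix x assume x: "x \<in> sparse m \<inter> ball 0 (real M)"
    then obtain p where p: "p \<in> D j" "dist p x < 5 * r j" using j(2) by (auto simp: sparse_def)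
    have "1 / real (Suc j) \<le> 1" by simp
    then have "5 * r j \<le> 1" using r_small[of j] r_pos[of j] by linarith
    moreover have "norm x < real j" using x j(1) by simp
    ultimately have "norm p \<le> Suc j"
      using p(2) norm_triangle_sub[of p x] by (simp add: dist_norm)
    with p show "x \<in> (\<Union>p\<in>P. cball p (5 * r j))" by (auto simp: P_def intro!: bexI[of _ p])
  qed
  moreover have "closed (\<Union>p\<in>P. cball p (5 * r j))" using \<open>finite P\<close> by (intro closed_UN) auto
  ultimately have "closure (sparse m \<inter> ball 0 (real M)) \<subseteq> (\<Union>p\<in>P. cball p (5 * r j))"
    by (rule closure_minimal)
  moreover have "closure (sparse m) \<inter> ball 0 (real M) \<subseteq> closure (sparse m \<inter> ball 0 (real M))"
    using open_Int_closure_subset[of "ball 0 (real M)" "sparse m"] by (simp add: Int_commute)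
  ultimately have "closure (sparse m) \<inter> ball 0 (real M) \<subseteq> (\<Union>i. U i)"
    using U(1) unfolding delta_covering_def by blast
  moreover have "bounded (U i) \<and> diameter (U i) \<le> \<delta>" for i
  proof -
    have "diameter (U i) \<le> 2 * (5 * r j)" "bounded (U i)"
      using U(1) unfolding delta_covering_def by blast+
    then show ?thesis using r_small[of j] j_small(1) by linarith
  qed
  ultimately have "delta_covering \<delta> (closure (sparse m) \<inter> ball 0 (real M)) U"
    unfolding delta_covering_def by blast
  moreover have "(\<Sum>i. h (diameter (U i))) \<le> ennreal \<epsilon>"
  proof -
    have "(\<Sum>i. h (diameter (U i))) \<le> ennreal (1 / Suc j)"
      using net_null[of j] by (simp add: U(2) P_def)
    also have "\<dots> \<le> ennreal \<epsilon>" using j_small(2) by (rule ennreal_leI)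
    finally show ?thesis .
  qed
  ultimately show "\<exists>U. delta_covering \<delta> (closure (sparse m) \<inter> ball 0 (real M)) U \<and>
      (\<Sum>i. h (diameter (U i))) \<le> ennreal \<epsilon>" by blast
qed

section \<open>The attractor and its images\<close>

text \<open>
  Removing \<open>cball 0 m\<close> makes the union locally finite, so that the closure stays null.
\<close>
definition attractor :: "'a set" where
  "attractor = closure (\<Union>m. sparse m - cball 0 (real m))"

text \<open>Removing a closed ball from \<open>sparse m\<close> leaves a relatively open part, so
  its points remain limit points; the closure of a set consisting of limit points of itself has no
  isolated points.\<close>

lemma perfect_attractor: "perfect_set attractor"
proof -
  let ?X = "\<Union>m. sparse m - cball 0 (real m)"
  have "x islimpt ?X" if x: "x \<in> ?X" for x
  proof (rule islimptI)
    fix T assume T: "x \<in> T" "open T"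
    obtain m where m: "x \<in> sparse m" "x \<notin> cball 0 (real m)" using x by blast
    have "open (T - cball 0 (real m))" using T(2) by (intro open_Diff closed_cball)
    then obtain z where "z \<in> sparse m \<inter> (T - cball 0 (real m))" "z \<noteq> x"
      using sparse_islimpt[OF m(1)] m(2) T(1) by (metis DiffI)
    then show "\<exists>y\<in>?X. y \<in> T \<and> y \<noteq> x" by blast
  qed
  then have "x islimpt ?X" if "x \<in> attractor" for x
    using that by (auto simp: attractor_def closure_def)
  then have "x islimpt attractor" if "x \<in> attractor" for x
    using that islimpt_subset[OF _ closure_subset] unfolding attractor_def by blast
  then show ?thesis
    by (auto simp: perfect_set_def isolated_in_islimpt_iff attractor_def)
qed

lemma attractor_null: "hausdorff_null h attractor"
proof (rule hausdorff_null_subset)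
  show "hausdorff_null h (\<Union>M. \<Union>m. closure (sparse m) \<inter> ball 0 (real M))"
    by (intro hausdorff_null_UN sparse_null)
  show "attractor \<subseteq> (\<Union>M. \<Union>m. closure (sparse m) \<inter> ball 0 (real M))"
  proof
    fix x assume x: "x \<in> attractor"
    obtain M where M: "norm x < real M" using reals_Archimedean2 by blast
    let ?X = "\<Union>m. sparse m - cball 0 (real m)"
    have "x \<in> ball 0 (real M) \<inter> closure ?X" using x M by (simp add: attractor_def)
    also have "\<dots> \<subseteq> closure (ball 0 (real M) \<inter> ?X)"
      by (rule open_Int_closure_subset) simp
    \<comment> \<open>A point of the \<open>m\<close>-th piece has norm greater than
      \<open>m\<close>, so only pieces with \<open>m < M\<close> meet the ball, and closure commutes
      with this finite union.\<close>
    also have "\<dots> \<subseteq> closure (\<Union>m<M. sparse m)"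
      by (rule closure_mono) force
    also have "\<dots> \<subseteq> (\<Union>m<M. closure (sparse m))"
      by (intro closure_minimal closed_UN UN_mono closure_subset) auto
    finally show "x \<in> (\<Union>M. \<Union>m. closure (sparse m) \<inter> ball 0 (real M))" using M by auto
  qed
qed

text \<open>With distinct roles, each stage constrains at most one map, so nested balls give one
  \<open>z\<close> whose preimages all lie in the required sparse sets. Starting far out keeps each
  preimage outside the ball removed from its set.\<close>

lemma attractor_images_meet:
  assumes fin: "finite F" and bil: "\<And>f. f \<in> F \<Longrightarrow> bilipschitz f"
  shows "(\<Inter>f\<in>F. f ` attractor) \<noteq> {}"
proof -
  obtain K where K: "1 \<le> K"
    and Kf: "\<And>f x y. f \<in> F \<Longrightarrow> dist (f x) (f y) \<le> K * dist x y"
    and Kg: "\<And>f x y. f \<in> F \<Longrightarrow> dist (inv f x) (inv f y) \<le> K * dist x y"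
    using uniform_bilipschitz_constant[OF fin bil] by metis
  have bij: "bij f" if "f \<in> F" for f using bil that by (intro bilipschitz_bij)
  have f_inv: "f (inv f x) = x" if "f \<in> F" for f x
    using bij[OF that] by (simp add: bij_is_surj surj_f_inv_f)
  have inv_f: "inv f (f x) = x" if "f \<in> F" for f x
    using bij[OF that] by (simp add: bij_is_inj)
  obtain J where J: "K \<le> real J" using real_arch_simple by blast
  obtain e :: "('a \<Rightarrow> 'a) \<Rightarrow> nat" where e: "inj_on e F"
    using finite_imp_inj_to_nat_seg[OF fin] by blast
  \<comment> \<open>Since \<open>role j \<le> j\<close>, a role above \<open>J\<close> occurs only
    at stages after \<open>J\<close>, so the nested balls starting at \<open>J\<close> miss none of
    its stages.\<close>
  define \<mu> where "\<mu> = (\<lambda>f. Suc (J + e f))"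
  define \<phi> where "\<phi> = inv_into F \<mu>"
  have "inj_on \<mu> F" using e by (auto simp: \<mu>_def inj_on_def)
  then have \<phi>: "\<phi> (\<mu> f) = f" if "f \<in> F" for f using that by (simp add: \<phi>_def)
  have \<phi>_in: "\<phi> m \<in> F" if "m \<in> \<mu> ` F" for m using \<phi> that by auto
  \<comment> \<open>Since \<open>norm z \<le> norm (f 0) + K * norm (inv f z)\<close>, the bound
    \<open>b f \<le> norm z\<close> forces \<open>norm (inv f z)\<close> above
    \<open>\<mu> f\<close>; the 1 gives strictness.\<close>
  define b where "b f = norm (f 0) + K * real (\<mu> f) + 1" for f :: "'a \<Rightarrow> 'a"
  have b_nonneg: "0 \<le> b f" for f using K by (simp add: b_def)
  \<comment> \<open>The extra 1 pays for the distance from \<open>y\<close> to \<open>z\<close>,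
    which is at most \<open>r J / K \<le> 1\<close>.\<close>
  obtain y :: 'a where y: "norm y = sum b F + 1"
    using vector_choose_size[of "sum b F + 1"] b_nonneg by (auto simp: sum_nonneg)
  obtain z where z: "dist y z \<le> r J / K"
    and z_net: "\<And>j. J < j \<Longrightarrow> role j \<in> \<mu> ` F \<Longrightarrow> \<exists>p\<in>D j. dist p (inv (\<phi> (role j)) z) \<le> r j"
  proof (rule nested_balls[of K J "\<mu> ` F" \<phi> "\<lambda>m. inv (\<phi> m)" y])
    fix m x x' assume "m \<in> \<mu> ` F"
    then have "\<phi> m \<in> F" by (rule \<phi>_in)
    then show "dist (\<phi> m x) (\<phi> m x') \<le> K * dist x x'"
      and "dist (inv (\<phi> m) x) (inv (\<phi> m) x') \<le> K * dist x x'"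
      and "\<phi> m (inv (\<phi> m) x) = x" and "inv (\<phi> m) (\<phi> m x) = x"
      by (rule Kf Kg f_inv inv_f)+
  qed (use K J in auto)
  have "r J / K \<le> 1"
  proof -
    have "1 / real (Suc J) \<le> 1" by simp
    then have "r J \<le> 1" using r_small[of J] r_pos[of J] by linarith
    then show ?thesis using K by (simp add: field_simps)
  qed
  then have z_far: "sum b F \<le> norm z"
    using z y norm_triangle_sub[of y z] by (simp add: dist_norm)
  have "z \<in> f ` attractor" if "f \<in> F" for f
  proof -
    let ?x = "inv f z"
    have net: "\<exists>p\<in>D j. dist p ?x \<le> r j" if "role j = \<mu> f" for j
    proof -
      have "J < j" using role_le[of j] that by (simp add: \<mu>_def)
      then show ?thesis using z_net[of j] that \<phi> \<open>f \<in> F\<close> by auto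
    qed
    moreover have "r j < 5 * r j" for j using r_pos[of j] by simp
    ultimately have "?x \<in> sparse (\<mu> f)" unfolding sparse_def by (blast intro: le_less_trans)
    moreover have "real (\<mu> f) < norm ?x"
    proof -
      have "b f \<le> norm z"
        using member_le_sum[of f F b] that fin b_nonneg z_far by simp
      moreover have "norm z \<le> norm (f 0) + K * norm ?x"
        using Kf[OF that, of ?x 0] norm_triangle_sub[of z "f 0"]
        by (simp add: f_inv[OF that] dist_norm)
      ultimately have "K * real (\<mu> f) < K * norm ?x" by (simp add: b_def)
      then show ?thesis using K by simp
    qed
    ultimately have "?x \<in> attractor"
      unfolding attractor_def using closure_subset by fastforce
    then show ?thesis using f_inv[OF that] by (metis imageI)
  qed
  then show ?thesis by blast
qed

end

section \<open>Construction of the radii and nets\<close>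

text \<open>Right continuity at 0 together with \<open>h 0 = 0\<close> makes \<open>h\<close> finite
  and arbitrarily small near 0, so any fixed number of sufficiently small balls has negligible total
  \<open>h\<close>-size.\<close>

lemma dimension_function_small:
  assumes "dimension_function h" and "0 < \<epsilon>" "0 < \<eta>"
  shows "\<exists>\<rho>>0. \<rho> \<le> \<eta> \<and> of_nat n * h (10 * \<rho>) \<le> ennreal \<epsilon>"
proof -
  have "h 0 = 0" "continuous (at_right 0) h"
    using assms(1) by (auto simp: dimension_function_def)
  then have lim: "(h \<longlongrightarrow> 0) (at_right 0)" by (simp add: continuous_within)
  \<comment> \<open>Dividing by \<open>Suc n\<close> keeps the bound meaningful for
    \<open>n = 0\<close>.\<close>
  have "\<forall>\<^sub>F t in at_right 0. h t < ennreal (\<epsilon> / Suc n)"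
    using order_tendstoD(2)[OF lim, of "ennreal (\<epsilon> / Suc n)"] assms(2) by simp
  then obtain b where b: "0 < b" "\<And>t. 0 < t \<Longrightarrow> t < b \<Longrightarrow> h t < ennreal (\<epsilon> / Suc n)"
    unfolding eventually_at_right_field by blast
  define \<rho> where "\<rho> = min \<eta> (b / 20)"
  have \<rho>: "0 < \<rho>" "\<rho> \<le> \<eta>" "10 * \<rho> < b" using b(1) assms(3) by (auto simp: \<rho>_def)
  have "of_nat n * h (10 * \<rho>) \<le> ennreal (real n) * ennreal (\<epsilon> / Suc n)"
    using b(2)[of "10 * \<rho>"] \<rho> by (intro mult_mono) (auto simp: ennreal_of_nat_eq_real_of_nat)
  also have "\<dots> = ennreal (real n * (\<epsilon> / Suc n))"
    using assms(2) by (intro ennreal_mult[symmetric]) auto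
  also have "\<dots> \<le> ennreal \<epsilon>"
    using assms(2) by (intro ennreal_leI) (simp add: field_simps)
  finally show ?thesis using \<rho> by blast
qed

text \<open>The order of choices avoids circularity: the old radius fixes the fineness of the next
  net, the net fixes the number of points in the bounded region, and only then is the new radius
  chosen small enough for that number.\<close>

lemma sparse_nets_exist:
  assumes "dimension_function h"
  obtains r and D :: "nat \<Rightarrow> 'a::euclidean_space set" where "sparse_nets h r D"
proof -
  define P where "P = (\<lambda>j (\<rho>, N :: 'a set). 0 < \<rho> \<and> 10 * \<rho> \<le> 1 / Suc j \<and>
    (\<forall>R. finite (N \<inter> cball 0 R)) \<and>
    of_nat (card (N \<inter> cball 0 (Suc j))) * h (10 * \<rho>) \<le> ennreal (1 / Suc j))"
  define Q where "Q = (\<lambda>j (\<rho>, N :: 'a set) (\<rho>', N' :: 'a set).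
    \<forall>x. \<exists>p\<in>N'. (Suc j)\<^sup>2 * dist x p + \<rho>' \<le> \<rho>)"
  have next_net: "\<exists>\<rho> N. P j (\<rho>, N) \<and> \<rho> \<le> \<eta> \<and> (\<forall>x. \<exists>p\<in>N. dist x p < s)"
    if s: "0 < s" and \<eta>: "0 < \<eta>" for s \<eta> :: real and j
  proof -
    obtain N :: "'a set" where N: "\<And>R. finite (N \<inter> cball 0 R)" "\<And>x. \<exists>p\<in>N. dist x p < s"
      using locally_finite_net[OF s] by blast
    have "0 < 1 / real (Suc j)" "0 < min \<eta> (1 / (10 * real (Suc j)))" using \<eta> by auto
    from dimension_function_small[OF assms this, of "card (N \<inter> cball 0 (Suc j))"]
    obtain \<rho> where \<rho>: "0 < \<rho>" "\<rho> \<le> \<eta>" "\<rho> \<le> 1 / (10 * real (Suc j))"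
      "of_nat (card (N \<inter> cball 0 (Suc j))) * h (10 * \<rho>) \<le> ennreal (1 / Suc j)"
      by auto
    have "P j (\<rho>, N)" using \<rho> N(1) by (simp add: P_def field_simps)
    with \<rho>(2) N(2) show ?thesis by blast
  qed
  have "\<exists>q. \<forall>j. P j (q j) \<and> Q j (q j) (q (Suc j))"
  proof (rule dependent_nat_choice)
    \<comment> \<open>The fineness of the first net is arbitrary, since the density condition
      concerns only later nets.\<close>
    show "\<exists>q. P 0 q" using next_net[of 1 1 0] by auto
  next
    fix q j assume "P j q"
    obtain \<rho> N where q: "q = (\<rho>, N)" by (cases q)
    have "0 < \<rho>" using \<open>P j q\<close> by (simp add: P_def q)
    \<comment> \<open>Half of \<open>\<rho>\<close> is reserved for the scaled distance to the net,
      the other half for the next radius.\<close>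
    define s where "s = \<rho> / 2 / (Suc j)\<^sup>2"
    have "0 < s" "0 < \<rho> / 2" using \<open>0 < \<rho>\<close> by (auto simp: s_def)
    from next_net[OF this, of "Suc j"]
    obtain \<rho>' N' where *: "P (Suc j) (\<rho>', N')" "\<rho>' \<le> \<rho> / 2" "\<And>x. \<exists>p\<in>N'. dist x p < s"
      by blast
    have "\<exists>p\<in>N'. (Suc j)\<^sup>2 * dist x p + \<rho>' \<le> \<rho>" for x
    proof -
      obtain p where p: "p \<in> N'" "dist x p < s" using *(3) by blast
      have "(Suc j)\<^sup>2 * dist x p \<le> (Suc j)\<^sup>2 * s"
        using p(2) by (intro mult_left_mono) auto
      also have "\<dots> = \<rho> / 2" unfolding s_def by (simp del: of_nat_Suc)
      finally show ?thesis using *(2) p(1) by (intro bexI[of _ p]) auto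
    qed
    then have "Q j q (\<rho>', N')" by (simp add: Q_def q)
    with *(1) show "\<exists>q'. P (Suc j) q' \<and> Q j q q'" by blast
  qed
  then obtain q where q: "\<And>j. P j (q j)" "\<And>j. Q j (q j) (q (Suc j))" by blast
  have "h 0 = 0" using assms by (simp add: dimension_function_def)
  have "sparse_nets h (fst \<circ> q) (snd \<circ> q)"
  proof
    show "h 0 = 0" by fact
  next
    fix j R x
    show "0 < (fst \<circ> q) j" "10 * (fst \<circ> q) j \<le> 1 / Suc j" "finite ((snd \<circ> q) j \<inter> cball 0 R)"
      "of_nat (card ((snd \<circ> q) j \<inter> cball 0 (Suc j))) * h (10 * (fst \<circ> q) j) \<le> ennreal (1 / Suc j)"
      using q(1)[of j] by (simp_all add: P_def split_beta)
    show "\<exists>p\<in>(snd \<circ> q) (Suc j). (Suc j)\<^sup>2 * dist x p + (fst \<circ> q) (Suc j) \<le> (fst \<circ> q) j"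
      using q(2)[of j] by (simp add: Q_def split_beta)
  qed
  then show thesis by (rule that)
qed

theorem corollary3p5:
  fixes h :: "real \<Rightarrow> ennreal"
  assumes "dimension_function h"
  shows "\<exists>E :: (real ^ 'n) set. perfect_set E \<and> hausdorff_measure h E = 0 \<and>
           (\<forall>F. finite F \<and> F \<subseteq> {f :: real ^ 'n \<Rightarrow> real ^ 'n. bilipschitz f} \<longrightarrow>
              (\<Inter>f\<in>F. f ` E) \<noteq> {})"
proof -
  obtain r and D :: "nat \<Rightarrow> (real ^ 'n) set" where "sparse_nets h r D"
    using sparse_nets_exist[OF assms] by blast
  then interpret sparse_nets h r D .
  have "(\<Inter>f\<in>F. f ` attractor) \<noteq> {}" if "finite F \<and> F \<subseteq> {f. bilipschitz f}" for F
    using that by (intro attractor_images_meet) auto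
  then show ?thesis
    using perfect_attractor hausdorff_measure_null[OF attractor_null]
    by (intro exI[of _ attractor]) blast
qed

end
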